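(* Let $G$ be a connected graph with $\mathrm{diam}(G)=3$, and let $x$ be a vertex of $G$ with $ecc_G(x)=\mathrm{diam}(G)=3$. For $i=1,2,3$ let $n_i=|N_G^i(x)|$, where $N_G^i(x)=\{v\in V(G): dist_G(x,v)=i\}$. If one of the following holds: (i) $n_1=n_2=n_3=1$; (ii) $n_1=n_2=1$ and $n_3\geq 2$; (iii) $n_2=1$ and $n_1,n_3\geq 2$, then $rc(\overline{G})\leq 5$. Furthermore, if $G$ is triangle-free and $\overline{G}$ is connected, then $rc(\overline{G})\leq 5$.
   Context: All graphs are finite, undirected and simple. For an edge-coloring $c:E(H)\to\{1,\dots,k\}$ (adjacent edges may receive the same color), a path is rainbow if no two of its edges have the same color; $H$ is rainbow connected under $c$ if every two vertices are joined by a rainbow path. The rainbow connection number $rc(H)$ of a nontrivial connected graph $H$ is the minimum $k$ for which such a coloring with $k$ colors exists. $dist_G(u,v)$ is the length of a shortest $u$–$v$ path in $G$, $ecc_G(v)=\max_{y\in V(G)} dist_G(v,y)$, $\mathrm{diam}$ denotes diameter, and $\overline{G}$ the complement of $G$. *)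

theory Defs
  imports "HOL-Library.Extended_Nat" "HOL-Library.FuncSet"
begin

text \<open>A graph is given by its vertex set and its set of edges, an edge being the set of its two ends.\<close>

definition simple_graph :: "'a set \<Rightarrow> 'a set set \<Rightarrow> bool" where
  "simple_graph V E \<longleftrightarrow> finite V \<and> (\<forall>e\<in>E. e \<subseteq> V \<and> card e = 2)"

definition complement_edges :: "'a set \<Rightarrow> 'a set set \<Rightarrow> 'a set set" where
  "complement_edges V E = {e. e \<subseteq> V \<and> card e = 2 \<and> e \<notin> E}"

text \<open>A path is the list of its (pairwise distinct) vertices; its length is the number of its edges.\<close>

definition path_between :: "'a set \<Rightarrow> 'a set set \<Rightarrow> 'a \<Rightarrow> 'a list \<Rightarrow> 'a \<Rightarrow> bool" where
  "path_between V E u p v \<longleftrightarrow>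
     p \<noteq> [] \<and> hd p = u \<and> last p = v \<and> set p \<subseteq> V \<and> distinct p \<and>
     successively (\<lambda>a b. {a, b} \<in> E) p"

definition path_edges :: "'a list \<Rightarrow> 'a set list" where
  "path_edges p = map (\<lambda>(a, b). {a, b}) (zip p (tl p))"

definition connected_graph :: "'a set \<Rightarrow> 'a set set \<Rightarrow> bool" where
  "connected_graph V E \<longleftrightarrow> V \<noteq> {} \<and> (\<forall>u\<in>V. \<forall>v\<in>V. \<exists>p. path_between V E u p v)"

text \<open>Distances are \<open>\<infinity>\<close> between vertices not joined by any path.\<close>

definition graph_dist :: "'a set \<Rightarrow> 'a set set \<Rightarrow> 'a \<Rightarrow> 'a \<Rightarrow> enat" where
  "graph_dist V E u v = Inf {enat (length (path_edges p)) | p. path_between V E u p v}"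

definition ecc :: "'a set \<Rightarrow> 'a set set \<Rightarrow> 'a \<Rightarrow> enat" where
  "ecc V E v = (SUP y\<in>V. graph_dist V E v y)"

definition diam :: "'a set \<Rightarrow> 'a set set \<Rightarrow> enat" where
  "diam V E = (SUP (u, v)\<in>V \<times> V. graph_dist V E u v)"

definition sphere_at :: "'a set \<Rightarrow> 'a set set \<Rightarrow> nat \<Rightarrow> 'a \<Rightarrow> 'a set" where
  "sphere_at V E i x = {v \<in> V. graph_dist V E x v = enat i}"

definition triangle_free :: "'a set set \<Rightarrow> bool" where
  "triangle_free E \<longleftrightarrow> \<not> (\<exists>a b c. {a, b} \<in> E \<and> {b, c} \<in> E \<and> {a, c} \<in> E)"

definition rainbow_path :: "('a set \<Rightarrow> nat) \<Rightarrow> 'a list \<Rightarrow> bool" where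
  "rainbow_path c p \<longleftrightarrow> distinct (map c (path_edges p))"

definition rainbow_connected :: "'a set \<Rightarrow> 'a set set \<Rightarrow> ('a set \<Rightarrow> nat) \<Rightarrow> bool" where
  "rainbow_connected V E c \<longleftrightarrow>
     (\<forall>u\<in>V. \<forall>v\<in>V. \<exists>p. path_between V E u p v \<and> rainbow_path c p)"

text \<open>With values in \<^typ>\<open>enat\<close>, the infimum is attained whenever some admissible colouring exists,
  and it is \<open>\<infinity>\<close> for a disconnected graph; so a finite bound on \<open>rc\<close> includes connectedness.\<close>

definition rc :: "'a set \<Rightarrow> 'a set set \<Rightarrow> enat" where
  "rc V E = Inf {enat k | k. \<exists>c. c \<in> E \<rightarrow> {1..k} \<and> rainbow_connected V E c}"

end

theory Submission
  imports Defs
begin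

text \<open>
  Write \<open>A\<close>, \<open>B\<close>, \<open>C\<close> for the spheres of radius 1, 2, 3 around \<open>x\<close>. In the complement, \<open>x\<close> is
  joined to all of \<open>B \<union> C\<close>, and every vertex of \<open>A\<close> to every vertex of \<open>C\<close>.

  If \<open>B = {b}\<close>, the complement contains the complete bipartite graph between \<open>{x} \<union> A\<close> and \<open>C\<close>,
  which four colours make rainbow connected when both sides have two vertices, and \<open>b\<close> hangs on it
  by the edge \<open>xb\<close>, which gets a fifth colour.

  If the graph is triangle-free, give the edges of the complement of types \<open>xC\<close>, \<open>AC\<close>, \<open>xB\<close>, \<open>AB\<close>,
  \<open>BC\<close> five different colours. Then \<open>A\<close> is a clique of the complement. Adjacent \<open>b\<close>, \<open>b'\<close> are
  joined by \<open>b x c a b'\<close> where \<open>a\<close> is a neighbour of \<open>b\<close> in \<open>A\<close>, and adjacent \<open>c\<close>, \<open>c'\<close> by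
  \<open>c x b c'\<close> or \<open>c' x b c\<close>, because no \<open>b\<close> is a common neighbour of \<open>c\<close> and \<open>c'\<close>.
\<close>

section \<open>Rainbow paths\<close>

lemma path_edges_simps [simp]:
  "path_edges [] = []"
  "path_edges [a] = []"
  "path_edges (a # b # p) = {a, b} # path_edges (b # p)"
  by (simp_all add: path_edges_def)

lemma length_path_edges: "length (path_edges p) = length p - 1"
  by (simp add: path_edges_def)

lemma path_edges_append: "path_edges (p @ [a, b]) = path_edges (p @ [a]) @ [{a, b}]"
  by (induction p rule: induct_list012) auto

lemma path_edges_rev: "path_edges (rev p) = rev (path_edges p)"
  by (induction p rule: induct_list012) (auto simp: path_edges_append insert_commute)

lemma path_between_rev: "path_between V E u p v \<Longrightarrow> path_between V E v (rev p) u"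
  by (auto simp: path_between_def hd_rev last_rev insert_commute)

text \<open>The relation between one pair of vertices inside \<open>rainbow_connected\<close>. Being
  symmetric, it only has to be checked for one order of each pair of vertex classes.\<close>

definition rainbow_joined :: "'a set \<Rightarrow> 'a set set \<Rightarrow> ('a set \<Rightarrow> nat) \<Rightarrow> 'a \<Rightarrow> 'a \<Rightarrow> bool" where
  "rainbow_joined V E c u v \<longleftrightarrow> (\<exists>p. path_between V E u p v \<and> rainbow_path c p)"

lemma rainbow_joined_sym: "rainbow_joined V E c u v \<Longrightarrow> rainbow_joined V E c v u"
  unfolding rainbow_joined_def rainbow_path_def
  by (metis path_between_rev path_edges_rev rev_map distinct_rev)

lemma rainbow_joined_refl: "u \<in> V \<Longrightarrow> rainbow_joined V E c u u"
  unfolding rainbow_joined_def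
  by (rule exI[of _ "[u]"]) (simp add: path_between_def rainbow_path_def)

text \<open>The ends are written \<open>hd p\<close> and \<open>last p\<close> so that, for an
  explicit list \<open>p\<close>, simplification computes them along with the edges and
  colours.\<close>

lemma rainbow_joinedI:
  assumes "p \<noteq> []" "set p \<subseteq> V" "distinct p" "successively (\<lambda>a b. {a, b} \<in> E) p"
    and "distinct (map c (path_edges p))"
  shows "rainbow_joined V E c (hd p) (last p)"
  using assms unfolding rainbow_joined_def path_between_def rainbow_path_def by blast

lemma rc_le:
  assumes "c \<in> E \<rightarrow> {1..k}"
    and "\<And>u v. u \<in> V \<Longrightarrow> v \<in> V \<Longrightarrow> rainbow_joined V E c u v"
  shows "rc V E \<le> enat k"
  unfolding rc_def
  by (rule Inf_lower) (use assms in \<open>auto simp: rainbow_connected_def rainbow_joined_def\<close>)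

lemma complement_edgeI:
  "u \<in> V \<Longrightarrow> v \<in> V \<Longrightarrow> u \<noteq> v \<Longrightarrow> {u, v} \<notin> E \<Longrightarrow> {u, v} \<in> complement_edges V E"
  by (simp add: complement_edges_def)

section \<open>Spheres\<close>

lemma graph_dist_le: "path_between V E u p v \<Longrightarrow> graph_dist V E u v \<le> enat (length p - 1)"
  unfolding graph_dist_def by (rule Inf_lower) (auto simp: length_path_edges)

text \<open>A finite infimum comes from a nonempty set of lengths, since the infimum of the empty
  set is infinite; as \<open>enat\<close> is well-ordered, it is attained. A path with
  \<open>k\<close> edges has \<open>Suc k\<close> vertices.\<close>

lemma graph_dist_path:
  assumes "graph_dist V E u v = enat k"
  obtains p where "path_between V E u p v" "length p = Suc k"
proof -
  let ?D = "{enat (length (path_edges p)) | p. path_between V E u p v}"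
  have "?D \<noteq> {}"
  proof
    assume "?D = {}"
    then have "graph_dist V E u v = \<infinity>"
      unfolding graph_dist_def by (simp only: Inf_enat_def) simp
    then show False
      using assms by simp
  qed
  then obtain d where "d \<in> ?D"
    by blast
  then have "Inf ?D \<in> ?D"
    by (rule wellorder_InfI)
  then have "enat k \<in> ?D"
    using assms unfolding graph_dist_def by simp
  then obtain p where p: "path_between V E u p v" "length p - 1 = k"
    by (auto simp: length_path_edges)
  moreover have "p \<noteq> []"
    using p by (simp add: path_between_def)
  ultimately show thesis
    using that[of p] by (cases p) auto
qed

lemma graph_dist_self: "u \<in> V \<Longrightarrow> graph_dist V E u u = 0"
  using graph_dist_le[of V E u "[u]" u] by (simp add: path_between_def flip: zero_enat_def)

lemma graph_dist_eq_0: "graph_dist V E u v = enat 0 \<Longrightarrow> u = v"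
  by (erule graph_dist_path) (auto simp: path_between_def length_Suc_conv)

text \<open>Append \<open>w\<close> to a shortest path to \<open>v\<close>. Paths have distinct
  vertices, so if \<open>w\<close> already lies on it, the initial segment ending in
  \<open>w\<close> is taken instead.\<close>

lemma graph_dist_edge:
  assumes "{v, w} \<in> E" "w \<in> V" "graph_dist V E u v = enat k"
  shows "graph_dist V E u w \<le> enat (Suc k)"
proof -
  obtain p where p: "path_between V E u p v" "length p = Suc k"
    using assms(3) by (rule graph_dist_path)
  show ?thesis
  proof (cases "w \<in> set p")
    case True
    then obtain q r where qr: "p = (q @ [w]) @ r"
      by (auto dest: split_list)
    have "path_between V E u (q @ [w]) w"
      using p(1) unfolding qr path_between_def successively_append_iff[of _ "q @ [w]"]
      by (auto simp: hd_append)
    from graph_dist_le[OF this] show ?thesis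
      using p(2) qr by (simp add: order_trans)
  next
    case False
    have "path_between V E u (p @ [w]) w"
      using p(1) False assms(1,2) unfolding path_between_def
      by (auto simp: successively_append_iff)
    from graph_dist_le[OF this] show ?thesis
      using p(2) by simp
  qed
qed

text \<open>Crossing an edge raises the distance from \<open>x\<close> by at most one. This is the
  source of the edges of the complement between layers.\<close>

lemma sphere_at_no_edge:
  assumes "u \<in> sphere_at V E i x" "v \<in> sphere_at V E j x" "Suc i < j"
  shows "{u, v} \<notin> E"
  using assms graph_dist_edge[of u v E V x i] by (auto simp: sphere_at_def)

text \<open>The last vertex but one of a shortest path to \<open>v\<close> works: it is at distance
  at most \<open>k\<close>, and a smaller distance would bring \<open>v\<close> closer to
  \<open>x\<close>.\<close>

lemma sphere_at_pred:
  assumes "v \<in> sphere_at V E (Suc k) x"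
  obtains u where "u \<in> sphere_at V E k x" "{u, v} \<in> E"
proof -
  have v: "v \<in> V" "graph_dist V E x v = enat (Suc k)"
    using assms by (auto simp: sphere_at_def)
  obtain p where p: "path_between V E x p v" "length p = Suc (Suc k)"
    using v(2) by (rule graph_dist_path)
  define q where "q = butlast p"
  have "p = q @ [v]"
    using p(1) unfolding q_def path_between_def by (metis append_butlast_last_id)
  moreover have "length q = Suc k"
    using p(2) by (simp add: q_def)
  ultimately have pq: "p = q @ [v]" "length q = Suc k" "q \<noteq> []"
    by auto
  have q: "path_between V E x q (last q)" and e: "{last q, v} \<in> E"
    using p(1) pq(3) unfolding pq(1) path_between_def by (auto simp: successively_append_iff)
  have le: "graph_dist V E x (last q) \<le> enat k"
    using graph_dist_le[OF q] pq by simp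
  then obtain m where m: "graph_dist V E x (last q) = enat m" "m \<le> k"
    by (cases "graph_dist V E x (last q)") auto
  have "graph_dist V E x v \<le> enat (Suc m)"
    using graph_dist_edge[OF e v(1) m(1)] .
  then have "m = k"
    using v m by simp
  moreover have "last q \<in> V"
    using q pq(3) by (auto simp: path_between_def)
  ultimately show thesis
    using that[of "last q"] e m by (simp add: sphere_at_def)
qed

section \<open>Colourings of the complement\<close>

lemma rc_complement_singleton_layer:
  assumes V: "V = insert x (insert b (A \<union> C))"
    and disj: "x \<noteq> b" "x \<notin> A" "x \<notin> C" "b \<notin> A" "b \<notin> C" "A \<inter> C = {}"
    and C: "c0 \<in> C"
    and small: "C \<noteq> {c0} \<or> (\<exists>a. A = {a})"
    and ne: "{x, b} \<notin> E" "\<And>c. c \<in> C \<Longrightarrow> {x, c} \<notin> E" "\<And>a c. a \<in> A \<Longrightarrow> c \<in> C \<Longrightarrow> {a, c} \<notin> E"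
    and A: "A \<noteq> {}"
  shows "rc V (complement_edges V E) \<le> 5"
proof -
  let ?H = "complement_edges V E"
  \<comment> \<open>Around a 4-cycle \<open>x\<close>, \<open>c0\<close>, \<open>a\<close>,
    \<open>c\<close> the colours are 1, 3, 4, 2, and 5 is kept for \<open>{x, b}\<close>. Edges of
    other kinds receive a default colour and lie on none of the paths chosen below.\<close>
  define col :: "'a set \<Rightarrow> nat" where
    "col e = (if e = {x, b} then 5 else if e = {x, c0} then 1 else if x \<in> e then 2
              else if c0 \<in> e then 3 else 4)" for e
  let ?J = "rainbow_joined V ?H col"
  note J = rainbow_joinedI[of _ V ?H col]
  have dist: "x \<noteq> b" "b \<noteq> x" "c0 \<noteq> x" "x \<noteq> c0" "c0 \<noteq> b" "b \<noteq> c0"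
    "a \<in> A \<Longrightarrow> a \<noteq> x \<and> a \<noteq> b \<and> a \<noteq> c0 \<and> x \<noteq> a \<and> b \<noteq> a \<and> c0 \<noteq> a"
    "c \<in> C \<Longrightarrow> c \<noteq> x \<and> c \<noteq> b \<and> x \<noteq> c \<and> b \<noteq> c"
    "a \<in> A \<Longrightarrow> c \<in> C \<Longrightarrow> a \<noteq> c \<and> c \<noteq> a" for a c
    using disj C by auto
  have H: "{x, b} \<in> ?H" "{b, x} \<in> ?H"
    "c \<in> C \<Longrightarrow> {x, c} \<in> ?H \<and> {c, x} \<in> ?H"
    "a \<in> A \<Longrightarrow> c \<in> C \<Longrightarrow> {a, c} \<in> ?H \<and> {c, a} \<in> ?H" for a c
    using ne disj V by (auto intro!: complement_edgeI simp: insert_commute)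
  have col: "col {x, b} = 5" "col {b, x} = 5" "col {x, c0} = 1" "col {c0, x} = 1"
    "c \<in> C \<Longrightarrow> c \<noteq> c0 \<Longrightarrow> col {x, c} = 2 \<and> col {c, x} = 2"
    "a \<in> A \<Longrightarrow> col {c0, a} = 3 \<and> col {a, c0} = 3"
    "a \<in> A \<Longrightarrow> c \<in> C \<Longrightarrow> c \<noteq> c0 \<Longrightarrow> col {a, c} = 4 \<and> col {c, a} = 4" for a c
    using dist by (auto simp: col_def doubleton_eq_iff)
  note rules = V H col dist C
  have xb: "?J x b"
    using J[of "[x, b]"] rules by simp
  have xc: "?J x c" if "c \<in> C" for c
    using J[of "[x, c]"] rules that by simp
  have xa: "?J x a" if "a \<in> A" for a
    using J[of "[x, c0, a]"] rules that by simp
  have bc: "?J b c" if "c \<in> C" for c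
    using J[of "[b, x, c]"] rules that by (cases "c = c0") simp_all
  have ba: "?J b a" if "a \<in> A" for a
    using J[of "[b, x, c0, a]"] rules that by simp
  have ac: "?J a c" if "a \<in> A" "c \<in> C" for a c
    using J[of "[a, c]"] rules that by simp
  have aa: "?J a a'" if "a \<in> A" "a' \<in> A" "a \<noteq> a'" for a a'
  proof -
    \<comment> \<open>Two vertices of \<open>A\<close> rule out the second alternative of
      \<open>small\<close>, so \<open>C\<close> has another vertex \<open>c\<close>. The path below
      then runs through the colours 4, 2, 1, 3.\<close>
    have "C \<noteq> {c0}"
      using small that by auto
    then obtain c where c: "c \<in> C" "c \<noteq> c0"
      using C by auto
    show ?thesis
      using J[of "[a, c, x, c0, a']"] rules that c by simp
  qed
  have cc0: "?J c c0" if "c \<in> C" "c \<noteq> c0" for c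
    using J[of "[c, x, c0]"] rules that by simp
  have cc: "?J c c'" if "c \<in> C" "c' \<in> C" "c \<noteq> c'" for c c'
  proof (cases "c = c0 \<or> c' = c0")
    case True
    then show ?thesis
      using cc0 that rainbow_joined_sym by metis
  next
    case False
    then have "c \<noteq> c0" "c' \<noteq> c0" "c0 \<noteq> c" "c0 \<noteq> c'"
      by auto
    moreover obtain a where "a \<in> A"
      using A by auto
    \<comment> \<open>The colours along this path are 4, 3, 1, 2.\<close>
    ultimately show ?thesis
      using J[of "[c, a, c0, x, c']"] rules that by simp
  qed
  have "?J u v" if "u \<in> V" "v \<in> V" for u v
  proof (cases "u = v")
    case False
    note joined = xb xc xa bc ba ac aa cc
    have "u = x \<or> u = b \<or> u \<in> A \<or> u \<in> C" "v = x \<or> v = b \<or> v \<in> A \<or> v \<in> C"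
      using that V by auto
    then show ?thesis
      using False by (elim disjE) (auto intro: joined joined[THEN rainbow_joined_sym])
  qed (use that rainbow_joined_refl in auto)
  then have "rc V ?H \<le> enat 5"
    by (intro rc_le[of col]) (auto simp: col_def)
  then show ?thesis
    by (simp add: numeral_eq_enat)
qed

lemma rc_complement_triangle_free_layers:
  assumes V: "V = insert x (A \<union> B \<union> C)"
    and disj: "x \<notin> A" "x \<notin> B" "x \<notin> C" "A \<inter> B = {}" "A \<inter> C = {}" "B \<inter> C = {}"
    and b0: "b0 \<in> B" and c0: "c0 \<in> C"
    and ne: "\<And>v. v \<in> B \<union> C \<Longrightarrow> {x, v} \<notin> E" "\<And>a c. a \<in> A \<Longrightarrow> c \<in> C \<Longrightarrow> {a, c} \<notin> E"
    and xA: "\<And>a. a \<in> A \<Longrightarrow> {x, a} \<in> E"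
    and AB: "\<And>b. b \<in> B \<Longrightarrow> \<exists>a\<in>A. {a, b} \<in> E"
    and tf: "triangle_free E"
  shows "rc V (complement_edges V E) \<le> 5"
proof -
  let ?H = "complement_edges V E"
  \<comment> \<open>Edges inside \<open>A\<close> fall under colour 4 and edges inside
    \<open>B\<close> or \<open>C\<close> under 5; they serve only as paths of a single edge.\<close>
  define col :: "'a set \<Rightarrow> nat" where
    "col e = (if x \<in> e then (if e \<inter> C \<noteq> {} then 1 else 3)
              else if e \<inter> A \<noteq> {} then (if e \<inter> C \<noteq> {} then 2 else 4)
              else 5)" for e
  let ?J = "rainbow_joined V ?H col"
  note J = rainbow_joinedI[of _ V ?H col]
  have tri: "{u, w} \<notin> E" if "{u, v} \<in> E" "{v, w} \<in> E" for u v w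
    using tf that unfolding triangle_free_def by blast
  have dist:
    "a \<in> A \<Longrightarrow> a \<noteq> x \<and> x \<noteq> a" "b \<in> B \<Longrightarrow> b \<noteq> x \<and> x \<noteq> b" "c \<in> C \<Longrightarrow> c \<noteq> x \<and> x \<noteq> c"
    "a \<in> A \<Longrightarrow> b \<in> B \<Longrightarrow> a \<noteq> b \<and> b \<noteq> a" "a \<in> A \<Longrightarrow> c \<in> C \<Longrightarrow> a \<noteq> c \<and> c \<noteq> a"
    "b \<in> B \<Longrightarrow> c \<in> C \<Longrightarrow> b \<noteq> c \<and> c \<noteq> b" for a b c
    using disj by auto
  have H: "b \<in> B \<Longrightarrow> {x, b} \<in> ?H \<and> {b, x} \<in> ?H"
    "c \<in> C \<Longrightarrow> {x, c} \<in> ?H \<and> {c, x} \<in> ?H"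
    "a \<in> A \<Longrightarrow> c \<in> C \<Longrightarrow> {a, c} \<in> ?H \<and> {c, a} \<in> ?H" for a b c
    using ne disj V by (auto intro!: complement_edgeI simp: insert_commute)
  have col: "b \<in> B \<Longrightarrow> col {x, b} = 3 \<and> col {b, x} = 3"
    "c \<in> C \<Longrightarrow> col {x, c} = 1 \<and> col {c, x} = 1"
    "a \<in> A \<Longrightarrow> c \<in> C \<Longrightarrow> col {a, c} = 2 \<and> col {c, a} = 2"
    "a \<in> A \<Longrightarrow> b \<in> B \<Longrightarrow> col {a, b} = 4 \<and> col {b, a} = 4"
    "b \<in> B \<Longrightarrow> c \<in> C \<Longrightarrow> col {b, c} = 5 \<and> col {c, b} = 5" for a b c
    using disj by (auto simp: col_def)
  note rules = V H col dist b0 c0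
  have adj: "?J u v" if "u \<in> V" "v \<in> V" "u \<noteq> v" "{u, v} \<notin> E" for u v
    using J[of "[u, v]"] complement_edgeI[of u V v E] that by simp
  have xb: "?J x b" if "b \<in> B" for b
    using J[of "[x, b]"] rules that by simp
  have xc: "?J x c" if "c \<in> C" for c
    using J[of "[x, c]"] rules that by simp
  have xa: "?J x a" if "a \<in> A" for a
    using J[of "[x, c0, a]"] rules that by simp
  have bc: "?J b c" if "b \<in> B" "c \<in> C" for b c
    using J[of "[b, x, c]"] rules that by simp
  have ba: "?J b a" if "b \<in> B" "a \<in> A" for b a
    using J[of "[b, x, c0, a]"] rules that by simp
  have ac: "?J a c" if "a \<in> A" "c \<in> C" for a c
    using J[of "[a, c]"] rules that by simp
  \<comment> \<open>Both vertices are neighbours of \<open>x\<close> in the graph, so an edge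
    between them would close a triangle.\<close>
  have aa: "?J a a'" if "a \<in> A" "a' \<in> A" "a \<noteq> a'" for a a'
    using adj[of a a'] tri[of a x a'] xA[of a] xA[of a'] that V by (simp add: insert_commute)
  have bb: "?J b b'" if "b \<in> B" "b' \<in> B" "b \<noteq> b'" for b b'
  proof (cases "{b, b'} \<in> E")
    case True
    obtain a where a: "a \<in> A" "{a, b} \<in> E"
      using AB \<open>b \<in> B\<close> by blast
    \<comment> \<open>Otherwise \<open>a\<close>, \<open>b\<close>, \<open>b'\<close> would form a
      triangle. The path below has the colours 3, 1, 2, 4.\<close>
    have "{a, b'} \<in> ?H"
      using complement_edgeI[of a V b' E] tri[OF a(2) True] a that dist(4) V by auto
    then show ?thesis
      using J[of "[b, x, c0, a, b']"] rules that a by simp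
  qed (use adj that V in auto)
  \<comment> \<open>The colours are 1, 3, 5. Only the end \<open>c'\<close> must be a non-neighbour
    of \<open>b0\<close>, so either end of a pair may take this role by symmetry.\<close>
  have via: "?J c c'" if "c \<in> C" "c' \<in> C" "c \<noteq> c'" "{b0, c'} \<notin> E" for c c'
    using J[of "[c, x, b0, c']"] complement_edgeI[of b0 V c' E] rules that by simp
  have cc: "?J c c'" if "c \<in> C" "c' \<in> C" "c \<noteq> c'" for c c'
  proof (cases "{c, c'} \<in> E")
    case True
    then have "{b0, c} \<notin> E \<or> {b0, c'} \<notin> E"
      using tri by blast
    then show ?thesis
      using via that rainbow_joined_sym by metis
  qed (use adj that V in auto)
  have "?J u v" if "u \<in> V" "v \<in> V" for u v
  proof (cases "u = v")
    case False
    note joined = xb xc xa bc ba ac aa bb cc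
    have "u = x \<or> u \<in> A \<or> u \<in> B \<or> u \<in> C" "v = x \<or> v \<in> A \<or> v \<in> B \<or> v \<in> C"
      using that V by auto
    then show ?thesis
      using False by (elim disjE) (auto intro: joined joined[THEN rainbow_joined_sym])
  qed (use that rainbow_joined_refl in auto)
  then have "rc V ?H \<le> enat 5"
    by (intro rc_le[of col]) (auto simp: col_def)
  then show ?thesis
    by (simp add: numeral_eq_enat)
qed

theorem theorem4p1:
  fixes V :: "'a set" and E :: "'a set set" and x :: 'a and n :: "nat \<Rightarrow> nat"
  assumes "simple_graph V E"
    and "connected_graph V E"
    and "diam V E = 3"
    and "x \<in> V"
    and "ecc V E x = 3"
    and "\<And>i. i \<in> {1, 2, 3} \<Longrightarrow> n i = card (sphere_at V E i x)"
  shows "((n 1 = 1 \<and> n 2 = 1 \<and> n 3 = 1)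
            \<or> (n 1 = 1 \<and> n 2 = 1 \<and> n 3 \<ge> 2)
            \<or> (n 2 = 1 \<and> n 1 \<ge> 2 \<and> n 3 \<ge> 2)
          \<longrightarrow> rc V (complement_edges V E) \<le> 5)
       \<and> (triangle_free E \<and> connected_graph V (complement_edges V E)
          \<longrightarrow> rc V (complement_edges V E) \<le> 5)"
proof -
  let ?S = "\<lambda>i. sphere_at V E i x"
  have S0: "?S 0 = {x}"
    using graph_dist_self[OF \<open>x \<in> V\<close>, of E] graph_dist_eq_0[of V E x] \<open>x \<in> V\<close>
    by (auto simp: sphere_at_def zero_enat_def)
  have disj: "?S i \<inter> ?S j = {}" if "i \<noteq> j" for i j
    using that by (auto simp: sphere_at_def)
  have x_notin: "x \<notin> ?S i" if "i \<noteq> 0" for i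
    using disj[of 0 i] S0 that by auto
  have V: "V = insert x (?S 1 \<union> ?S 2 \<union> ?S 3)"
  proof
    show "V \<subseteq> insert x (?S 1 \<union> ?S 2 \<union> ?S 3)"
    proof
      fix v assume v: "v \<in> V"
      have "graph_dist V E x v \<le> ecc V E x"
        unfolding ecc_def using v by (rule SUP_upper)
      then have "graph_dist V E x v \<le> enat 3"
        using assms(5) by (simp add: numeral_eq_enat)
      then obtain k where k: "graph_dist V E x v = enat k" "k \<le> 3"
        by (cases "graph_dist V E x v") auto
      then have "v \<in> ?S k" "k = 0 \<or> k = 1 \<or> k = 2 \<or> k = 3"
        using v by (auto simp: sphere_at_def)
      then show "v \<in> insert x (?S 1 \<union> ?S 2 \<union> ?S 3)"
        using S0 by blast
    qed
  qed (use \<open>x \<in> V\<close> in \<open>auto simp: sphere_at_def\<close>)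
  obtain c0 where c0: "c0 \<in> ?S 3"
  proof -
    have "finite V" "V \<noteq> {}"
      using assms(1,4) by (auto simp: simple_graph_def)
    \<comment> \<open>Over a finite nonempty vertex set the supremum is a maximum, so some vertex is
      at distance exactly 3.\<close>
    then have "ecc V E x \<in> graph_dist V E x ` V"
      unfolding ecc_def by (metis Max_Sup Max_in finite_imageI image_is_empty)
    then show thesis
      using that assms(5) by (auto simp: sphere_at_def numeral_eq_enat)
  qed
  obtain b0 where b0: "b0 \<in> ?S 2"
    using sphere_at_pred[of c0 V E 2 x] c0 by (auto simp: eval_nat_numeral)
  have AB: "\<exists>a\<in>?S 1. {a, b} \<in> E" if "b \<in> ?S 2" for b
    using sphere_at_pred[of b V E 1 x] that by (auto simp: eval_nat_numeral)
  have xA: "{x, a} \<in> E" if "a \<in> ?S 1" for a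
    using sphere_at_pred[of a V E 0 x] that S0 by auto
  have nex: "{x, v} \<notin> E" if "v \<in> ?S 2 \<union> ?S 3" for v
    using that sphere_at_no_edge[of x V E 0 x v 2] sphere_at_no_edge[of x V E 0 x v 3] S0 by auto
  have neA: "{a, c} \<notin> E" if "a \<in> ?S 1" "c \<in> ?S 3" for a c
    using that sphere_at_no_edge[of a V E 1 x c 3] by simp
  have n: "n 1 = card (?S 1)" "n 2 = card (?S 2)" "n 3 = card (?S 3)"
    using assms(6) by simp_all
  \<comment> \<open>The three numerical cases merge here: each has \<open>n 2 = 1\<close> and gives
    \<open>n 1 = 1\<close> or \<open>n 3 \<ge> 2\<close>, which is what the hypothesis
    \<open>small\<close> of the colouring lemma asks for.\<close>
  have "rc V (complement_edges V E) \<le> 5" if n2: "n 2 = 1" and n13: "n 1 = 1 \<or> n 3 \<ge> 2"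
  proof -
    obtain b where b: "?S 2 = {b}"
      using n2 n by (auto simp: card_1_singleton_iff)
    show ?thesis
    proof (rule rc_complement_singleton_layer[where A = "?S 1" and C = "?S 3" and ?c0.0 = c0])
      show "V = insert x (insert b (?S 1 \<union> ?S 3))"
        by (rule trans[OF V]) (use b in auto)
      show "?S 3 \<noteq> {c0} \<or> (\<exists>a. ?S 1 = {a})"
        using n13 n by (auto simp: card_1_singleton_iff)
      show "?S 1 \<noteq> {}"
        using AB b0 by auto
    qed (use b disj[of 1 2] disj[of 2 3] disj[of 1 3] x_notin[of 1] x_notin[of 2] x_notin[of 3]
          c0 nex neA in auto)
  qed
  moreover have "rc V (complement_edges V E) \<le> 5" if "triangle_free E"
    by (rule rc_complement_triangle_free_layers[OF V x_notin x_notin x_notin disj disj disj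
          b0 c0 nex neA xA AB that]) simp_all
  ultimately show ?thesis
    by auto
qed

end
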